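(* Let $T$ be an infinite rooted tree, let $\psi:T\to\mathbb{C}$ be a function and let $0<p<\infty$. Then the following are equivalent: (a) The multiplication operator $M_\psi:\mathbb{T}_\infty\to\mathbb{T}_p$ is bounded. (b) The multiplication operator $M_\psi:\mathbb{T}_{\infty,0}\to\mathbb{T}_{p,0}$ is bounded. (c) $\psi\in\mathbb{T}_p$. In this case, $\|M_\psi\|=\|\psi\|_p$.
   Context: Let $T$ be an infinite rooted tree with root $o$; $T$ also denotes its vertex set. For a vertex $v$, $|v|$ is the number of edges in the unique path from $o$ to $v$. For $n\in\mathbb{N}_0=\{0,1,2,\dots\}$, $D_n=\{v\in T:|v|=n\}$, and $c_n$ is the number of elements of $D_n$, assumed finite for each $n$ (so $1\le c_n<\infty$). For $f:T\to\mathbb{C}$ and $0<p<\infty$ put $M_p(n,f)=\left(\frac1{c_n}\sum_{|v|=n}|f(v)|^p\right)^{1/p}$, and $M_\infty(n,f)=\max_{|v|=n}|f(v)|$. For $0<p\le\infty$ put $\|f\|_p=\sup_{n\in\mathbb{N}_0}M_p(n,f)$, $\mathbb{T}_p=\{f:T\to\mathbb{C}:\|f\|_p<\infty\}$ and $\mathbb{T}_{p,0}=\{f\in\mathbb{T}_p:\lim_{n\to\infty}M_p(n,f)=0\}$ (with the same $\|\cdot\|_p$). For $\psi:T\to\mathbb{C}$, $M_\psi f=\psi f$ (pointwise product). $M_\psi:X\to Y$ is bounded if $\psi f\in Y$ for every $f\in X$ and $\|M_\psi\|:=\sup\{\|\psi f\|_Y/\|f\|_X: f\in X, f\neq0\}<\infty$;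 the norm formula holds for the operator in (a) as well as for the one in (b). *)

theory Defs
  imports "HOL-Analysis.Analysis"
begin

text \<open>
  A tree is given by its adjacency relation \<open>E\<close> on a vertex type; the vertex set is the whole type,
  so that functions on the tree are just functions \<open>'a \<Rightarrow> complex\<close>.
  Paths and cycles are lists of vertices.
\<close>

definition is_path :: "('a \<Rightarrow> 'a \<Rightarrow> bool) \<Rightarrow> 'a \<Rightarrow> 'a \<Rightarrow> 'a list \<Rightarrow> bool" where
  "is_path E u v xs \<longleftrightarrow>
     xs \<noteq> [] \<and> hd xs = u \<and> last xs = v \<and> distinct xs \<and> successively E xs"

definition is_cycle :: "('a \<Rightarrow> 'a \<Rightarrow> bool) \<Rightarrow> 'a list \<Rightarrow> bool" where
  "is_cycle E xs \<longleftrightarrow>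
     length xs \<ge> 3 \<and> distinct xs \<and> successively E xs \<and> E (last xs) (hd xs)"

definition is_tree :: "('a \<Rightarrow> 'a \<Rightarrow> bool) \<Rightarrow> bool" where
  "is_tree E \<longleftrightarrow> symp E \<and> irreflp E \<and> (\<forall>u v. \<exists>xs. is_path E u v xs) \<and> (\<nexists>xs. is_cycle E xs)"

definition depth :: "('a \<Rightarrow> 'a \<Rightarrow> bool) \<Rightarrow> 'a \<Rightarrow> 'a \<Rightarrow> nat" where
  "depth E r v = length (THE xs. is_path E r v xs) - 1"

definition level :: "('a \<Rightarrow> 'a \<Rightarrow> bool) \<Rightarrow> 'a \<Rightarrow> nat \<Rightarrow> 'a set" where
  "level E r n = {v. depth E r v = n}"

definition hardy_mean ::
  "('a \<Rightarrow> 'a \<Rightarrow> bool) \<Rightarrow> 'a \<Rightarrow> ennreal \<Rightarrow> nat \<Rightarrow> ('a \<Rightarrow> complex) \<Rightarrow> real" where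
  "hardy_mean E r p n f =
     (if p = \<infinity> then Max ((\<lambda>v. cmod (f v)) ` level E r n)
      else (1 / real (card (level E r n)) * (\<Sum>v\<in>level E r n. cmod (f v) powr enn2real p))
             powr (1 / enn2real p))"

definition hardy_norm :: "('a \<Rightarrow> 'a \<Rightarrow> bool) \<Rightarrow> 'a \<Rightarrow> ennreal \<Rightarrow> ('a \<Rightarrow> complex) \<Rightarrow> ennreal" where
  "hardy_norm E r p f = (SUP n. ennreal (hardy_mean E r p n f))"

definition hardy_space :: "('a \<Rightarrow> 'a \<Rightarrow> bool) \<Rightarrow> 'a \<Rightarrow> ennreal \<Rightarrow> ('a \<Rightarrow> complex) set" where
  "hardy_space E r p = {f. hardy_norm E r p f < \<infinity>}"

definition hardy_space0 :: "('a \<Rightarrow> 'a \<Rightarrow> bool) \<Rightarrow> 'a \<Rightarrow> ennreal \<Rightarrow> ('a \<Rightarrow> complex) set" where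
  "hardy_space0 E r p =
     {f \<in> hardy_space E r p. (\<lambda>n. hardy_mean E r p n f) \<longlonglongrightarrow> 0}"

definition mult_op :: "('a \<Rightarrow> complex) \<Rightarrow> ('a \<Rightarrow> complex) \<Rightarrow> ('a \<Rightarrow> complex)" where
  "mult_op \<psi> f = (\<lambda>v. \<psi> v * f v)"

text \<open>
  Below, \<open>X\<close> is one of the spaces above on a tree with finite levels, so \<open>normX f\<close> is neither \<open>0\<close>
  nor \<open>\<infinity>\<close> for nonzero \<open>f \<in> X\<close> and the quotient in \<open>ennreal\<close> is the usual one.
\<close>

definition op_norm ::
  "('a \<Rightarrow> complex) set \<Rightarrow> (('a \<Rightarrow> complex) \<Rightarrow> ennreal) \<Rightarrow> (('a \<Rightarrow> complex) \<Rightarrow> ennreal) \<Rightarrow>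
   (('a \<Rightarrow> complex) \<Rightarrow> ('a \<Rightarrow> complex)) \<Rightarrow> ennreal" where
  "op_norm X normX normY A = Sup {normY (A f) / normX f |f. f \<in> X \<and> f \<noteq> (\<lambda>_. 0)}"

definition bounded_op ::
  "('a \<Rightarrow> complex) set \<Rightarrow> (('a \<Rightarrow> complex) \<Rightarrow> ennreal) \<Rightarrow>
   ('a \<Rightarrow> complex) set \<Rightarrow> (('a \<Rightarrow> complex) \<Rightarrow> ennreal) \<Rightarrow>
   (('a \<Rightarrow> complex) \<Rightarrow> ('a \<Rightarrow> complex)) \<Rightarrow> bool" where
  "bounded_op X normX Y normY A \<longleftrightarrow> (\<forall>f\<in>X. A f \<in> Y) \<and> op_norm X normX normY A < \<infinity>"

text \<open>The description used in the definition of \<open>depth\<close> is proper: paths in a tree are unique.\<close>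

lemma cycle_of_diverging_paths:
  assumes sym: "symp E"
    and xs: "distinct (u # xs)" "successively E (u # xs)"
    and ys: "distinct (u # ys)" "successively E (u # ys)"
    and ne: "xs \<noteq> []" "ys \<noteq> []"
    and last: "last xs = last ys" and hd: "hd xs \<noteq> hd ys"
  shows "\<exists>zs. is_cycle E zs"
proof -
  have "\<exists>x\<in>set xs. x \<in> set ys"
    using ne last last_in_set by metis
  then obtain as x bs where 1: "xs = as @ x # bs" "x \<in> set ys" "\<forall>y\<in>set as. y \<notin> set ys"
    by (elim split_list_first_propE) blast
  obtain cs ds where 2: "ys = cs @ x # ds"
    using 1(2) by (meson split_list)
  have ne': "as \<noteq> [] \<or> cs \<noteq> []"
    using hd 1 2 by auto
  have "is_cycle E (u # as @ x # rev cs)"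
    unfolding is_cycle_def
  proof (intro conjI)
    show "length (u # as @ x # rev cs) \<ge> 3"
      using ne' by (cases as; cases cs) auto
    show "distinct (u # as @ x # rev cs)"
      using xs(1) ys(1) 1 2 by auto
    have sy: "(\<lambda>a b. E b a) = E"
      using sym by (auto simp: fun_eq_iff symp_def)
    have a: "successively E (u # as @ [x])"
      using xs(2) unfolding 1 by (auto simp: successively_append_iff successively_Cons hd_append split: if_splits)
    have b: "successively E (u # cs @ [x])"
      using ys(2) unfolding 2 by (auto simp: successively_append_iff successively_Cons hd_append split: if_splits)
    then have "successively E (rev (u # cs @ [x]))"
      by (simp only: successively_rev sy)
    then have c: "successively E (x # rev cs @ [u])"
      by simp
    show "successively E (u # as @ x # rev cs)"
      using a c by (auto simp: successively_append_iff successively_Cons hd_append split: if_splits)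
    show "E (last (u # as @ x # rev cs)) (hd (u # as @ x # rev cs))"
      using c by (auto simp: successively_append_iff successively_Cons last_rev hd_append split: if_splits)
  qed
  then show ?thesis ..
qed

lemma is_tree_path_unique:
  assumes E: "is_tree E" and "is_path E u v xs" "is_path E u v ys"
  shows "xs = ys"
  using assms(2,3)
proof (induction xs arbitrary: u ys)
  case Nil
  then show ?case by (simp add: is_path_def)
next
  case (Cons a xs)
  have [simp]: "a = u"
    using Cons.prems by (simp add: is_path_def)
  obtain ys' where ys: "ys = u # ys'"
    using Cons.prems by (cases ys) (auto simp: is_path_def)
  note P = Cons.prems[unfolded is_path_def ys]
  show ?case
  proof (cases "xs = [] \<or> ys' = []")
    case True
    then show ?thesis
      using P ys by (metis \<open>a = u\<close> distinct.simps(2) last.simps last_in_set)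
  next
    case False
    have sym: "symp E" and nc: "\<nexists>zs. is_cycle E zs"
      using E by (auto simp: is_tree_def)
    have "hd xs = hd ys'"
      using cycle_of_diverging_paths[OF sym, of u xs ys'] nc P False by auto
    moreover have "is_path E (hd xs) v xs" "is_path E (hd ys') v ys'"
      using P False by (auto simp: is_path_def successively_Cons)
    ultimately show ?thesis
      using Cons.IH ys by auto
  qed
qed

end

theory Submission
  imports Defs
begin

text \<open>
  On each level \<open>M_p(n, \<psi> f) \<le> M_p(n, \<psi>) M_\<infinity>(n, f)\<close>, which bounds every operator norm by
  \<open>\<parallel>\<psi>\<parallel>_p\<close>. Conversely, the indicator function of \<open>D_n\<close> has norm \<open>1\<close> and lies even in the small
  space, and multiplying it by \<open>\<psi>\<close> gives a function of norm at least \<open>M_p(n, \<psi>)\<close>. Hence the operator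
  norm equals \<open>\<parallel>\<psi>\<parallel>_p\<close> on either domain, whether or not it is finite.
\<close>

section \<open>Depth along paths and nonempty levels\<close>

lemma is_tree_depth_eq:
  assumes "is_tree E" "is_path E r v xs"
  shows "depth E r v = length xs - 1"
proof -
  have "(THE xs. is_path E r v xs) = xs"
    using assms is_tree_path_unique by (metis the_equality)
  then show ?thesis
    by (simp add: depth_def)
qed

text \<open>An initial segment of the path from the root to \<open>v\<close> is itself a path, so
  cutting it after \<open>n\<close> edges ends at a vertex of depth \<open>n\<close>.\<close>

lemma level_nonempty_of_depth_ge:
  assumes "is_tree E" "n \<le> depth E r v"
  shows "level E r n \<noteq> {}"
proof -
  obtain xs where xs: "is_path E r v xs"
    using assms(1) unfolding is_tree_def by blast
  then have "n < length xs"
    using is_tree_depth_eq[OF assms(1) xs] assms(2) by (cases xs) (auto simp: is_path_def)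
  \<comment> \<open>A path with \<open>n\<close> edges has \<open>Suc n\<close> vertices.\<close>
  let ?ys = "take (Suc n) xs"
  have "successively E (?ys @ drop (Suc n) xs)"
    using xs by (simp add: is_path_def)
  then have "successively E ?ys"
    unfolding successively_append_iff by blast
  then have "is_path E r (last ?ys) ?ys"
    using xs by (auto simp: is_path_def hd_take)
  from is_tree_depth_eq[OF assms(1) this] \<open>n < length xs\<close> have "depth E r (last ?ys) = n"
    by simp
  then show ?thesis
    by (auto simp: level_def)
qed

text \<open>Finitely many finite levels cannot exhaust an infinite tree, so there are vertices of
  depth at least \<open>n\<close>. Nonempty levels make \<open>Max\<close> meaningful and the
  indicator of a level nonzero.\<close>

lemma level_nonempty:
  assumes "is_tree E" "infinite (UNIV :: 'a set)" "\<And>n. finite (level E (r :: 'a) n)"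
  shows "level E r n \<noteq> {}"
proof -
  have "\<not> UNIV \<subseteq> (\<Union>k<n. level E r k)"
    using assms(2,3) by (meson finite_UN_I finite_lessThan finite_subset)
  then obtain v where "n \<le> depth E r v"
    by (auto simp: level_def subset_iff not_less)
  then show ?thesis
    using level_nonempty_of_depth_ge[OF assms(1)] by blast
qed

section \<open>Means on a single level\<close>

lemma hardy_mean_infinity_ge:
  assumes "finite (level E r n)" "v \<in> level E r n"
  shows "cmod (f v) \<le> hardy_mean E r \<infinity> n f"
  using assms by (simp add: hardy_mean_def)

lemma hardy_mean_nonneg:
  assumes "finite (level E r n)" "level E r n \<noteq> {}"
  shows "0 \<le> hardy_mean E r p n f"
proof (cases "p = \<infinity>")
  case True
  then show ?thesis
    using assms hardy_mean_infinity_ge norm_ge_zero by (metis ex_in_conv order_trans)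
qed (simp add: hardy_mean_def)

text \<open>Each term of the sum is at most \<open>cmod (\<psi> v) powr q * M powr q\<close>; the
  constant factor leaves the sum and the root. Only monotonicity of powers enters, so the exponents
  \<open>q < 1\<close> are covered as well.\<close>

lemma hardy_mean_mult_le:
  assumes fin: "finite (level E r n)" and ne: "level E r n \<noteq> {}"
    and p: "0 < p" "p < \<infinity>"
  shows "hardy_mean E r p n (mult_op \<psi> f) \<le> hardy_mean E r p n \<psi> * hardy_mean E r \<infinity> n f"
proof -
  define q where "q = enn2real p"
  define c where "c = 1 / real (card (level E r n))"
  define M where "M = hardy_mean E r \<infinity> n f"
  have q: "0 < q"
    using p by (simp add: q_def enn2real_positive_iff)
  have M: "0 \<le> M"
    unfolding M_def by (rule hardy_mean_nonneg[OF fin ne])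
  have c: "0 \<le> c"
    by (simp add: c_def)
  have mean: "hardy_mean E r p n g = (c * (\<Sum>v\<in>level E r n. cmod (g v) powr q)) powr (1 / q)" for g
    using p by (simp add: hardy_mean_def c_def q_def)
  have "(\<Sum>v\<in>level E r n. cmod (mult_op \<psi> f v) powr q)
      \<le> (\<Sum>v\<in>level E r n. cmod (\<psi> v) powr q * M powr q)"
  proof (rule sum_mono)
    fix v assume "v \<in> level E r n"
    then have "cmod (f v) powr q \<le> M powr q"
      unfolding M_def using q hardy_mean_infinity_ge[OF fin] by (intro powr_mono2) auto
    then show "cmod (mult_op \<psi> f v) powr q \<le> cmod (\<psi> v) powr q * M powr q"
      by (simp add: mult_op_def norm_mult powr_mult mult_left_mono)
  qed
  then have "hardy_mean E r p n (mult_op \<psi> f)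
      \<le> (c * ((\<Sum>v\<in>level E r n. cmod (\<psi> v) powr q) * M powr q)) powr (1 / q)"
    unfolding mean sum_distrib_right using q c
    by (intro powr_mono2 mult_left_mono mult_nonneg_nonneg sum_nonneg) auto
  also have "\<dots> = hardy_mean E r p n \<psi> * (M powr q) powr (1 / q)"
    unfolding mean mult.assoc[symmetric] by (rule powr_mult)
  \<comment> \<open>The exponents multiply to 1, and \<open>M powr 1 = M\<close> because
    \<open>M\<close> is nonnegative.\<close>
  also have "(M powr q) powr (1 / q) = M"
    using q M by (simp add: powr_powr)
  finally show ?thesis
    by (simp add: M_def)
qed

section \<open>From level means to norms and spaces\<close>

lemma hardy_mean_le_norm: "ennreal (hardy_mean E r p n f) \<le> hardy_norm E r p f"
  unfolding hardy_norm_def by (rule SUP_upper) simp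

lemma hardy_mean_bounded:
  assumes "f \<in> hardy_space E r p"
  obtains C where "\<And>n. hardy_mean E r p n f \<le> C"
proof -
  obtain C where C: "0 \<le> C" "hardy_norm E r p f = ennreal C"
    using assms by (auto simp: hardy_space_def less_top_ennreal)
  have "hardy_mean E r p n f \<le> C" for n
    using hardy_mean_le_norm[of E r p n f] C by (simp add: ennreal_le_iff)
  then show ?thesis
    by (rule that)
qed

lemma hardy_norm_mult_le:
  assumes fin: "\<And>n. finite (level E r n)" and ne: "\<And>n. level E r n \<noteq> {}"
    and p: "0 < p" "p < \<infinity>"
  shows "hardy_norm E r p (mult_op \<psi> f) \<le> hardy_norm E r p \<psi> * hardy_norm E r \<infinity> f"
  unfolding hardy_norm_def[of E r p "mult_op \<psi> f"]
proof (rule SUP_least)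
  fix n
  have "ennreal (hardy_mean E r p n (mult_op \<psi> f))
      \<le> ennreal (hardy_mean E r p n \<psi> * hardy_mean E r \<infinity> n f)"
    by (intro ennreal_leI hardy_mean_mult_le assms)
  \<comment> \<open>Both means are nonnegative, so \<open>ennreal\<close> respects their
    product.\<close>
  also have "\<dots> = ennreal (hardy_mean E r p n \<psi>) * ennreal (hardy_mean E r \<infinity> n f)"
    by (intro ennreal_mult hardy_mean_nonneg fin ne)
  also have "\<dots> \<le> hardy_norm E r p \<psi> * hardy_norm E r \<infinity> f"
    by (intro mult_mono hardy_mean_le_norm) auto
  finally show "ennreal (hardy_mean E r p n (mult_op \<psi> f)) \<le> \<dots>" .
qed

text \<open>A nonzero value at \<open>v\<close> is already seen by the maximum over the level of
  \<open>v\<close>. Positivity is what allows cancelling the norm in the operator quotient.\<close>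

lemma hardy_norm_infinity_pos:
  assumes fin: "\<And>n. finite (level E r n)" and "f \<noteq> (\<lambda>_. 0)"
  shows "0 < hardy_norm E r \<infinity> f"
proof -
  obtain v where "f v \<noteq> 0"
    using assms(2) by auto
  then have "0 < cmod (f v)"
    by simp
  also have "\<dots> \<le> hardy_mean E r \<infinity> (depth E r v) f"
    by (rule hardy_mean_infinity_ge[OF fin]) (simp add: level_def)
  finally have "0 < hardy_mean E r \<infinity> (depth E r v) f" .
  then have "0 < ennreal (hardy_mean E r \<infinity> (depth E r v) f)"
    by (simp only: ennreal_less_zero_iff)
  then show ?thesis
    by (rule less_le_trans[OF _ hardy_mean_le_norm])
qed

lemma mult_op_hardy_space:
  assumes fin: "\<And>n. finite (level E r n)" and ne: "\<And>n. level E r n \<noteq> {}"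
    and p: "0 < p" "p < \<infinity>"
    and "\<psi> \<in> hardy_space E r p" "f \<in> hardy_space E r \<infinity>"
  shows "mult_op \<psi> f \<in> hardy_space E r p"
  using hardy_norm_mult_le[OF fin ne p, of \<psi> f] assms(5,6)
  by (auto simp: hardy_space_def ennreal_mult_less_top intro: le_less_trans)

text \<open>The means of \<open>\<psi>\<close> need not tend to 0, but they are bounded by some
  \<open>C\<close>; the decay comes from \<open>f\<close>, and the means of the product are squeezed
  between 0 and \<open>C\<close> times those of \<open>f\<close>.\<close>

lemma mult_op_hardy_space0:
  assumes fin: "\<And>n. finite (level E r n)" and ne: "\<And>n. level E r n \<noteq> {}"
    and p: "0 < p" "p < \<infinity>"
    and \<psi>: "\<psi> \<in> hardy_space E r p" and f: "f \<in> hardy_space0 E r \<infinity>"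
  shows "mult_op \<psi> f \<in> hardy_space0 E r p"
proof -
  obtain C where C: "\<And>n. hardy_mean E r p n \<psi> \<le> C"
    using hardy_mean_bounded[OF \<psi>] by blast
  have lim: "(\<lambda>n. C * hardy_mean E r \<infinity> n f) \<longlonglongrightarrow> 0"
    using f by (auto simp: hardy_space0_def intro: tendsto_mult_right_zero)
  have le: "hardy_mean E r p n (mult_op \<psi> f) \<le> C * hardy_mean E r \<infinity> n f" for n
    using hardy_mean_mult_le[OF fin ne p] mult_right_mono[OF C hardy_mean_nonneg[OF fin ne]]
    by (rule order_trans)
  have "(\<lambda>n. hardy_mean E r p n (mult_op \<psi> f)) \<longlonglongrightarrow> 0"
    by (rule tendsto_sandwich[OF _ _ tendsto_const lim])
      (intro always_eventually allI le hardy_mean_nonneg fin ne)+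
  then show ?thesis
    using mult_op_hardy_space[OF fin ne p \<psi>] f by (auto simp: hardy_space0_def)
qed

section \<open>Indicators of levels and the operator norm\<close>

lemma hardy_mean_indicator_level:
  assumes "level E r m \<noteq> {}"
  shows "hardy_mean E r \<infinity> m (indicator (level E r n)) = (if m = n then 1 else 0)"
proof -
  \<comment> \<open>Distinct levels are disjoint, so the indicator is constant on each level; as
    level \<open>m\<close> is nonempty, the image is a singleton.\<close>
  have "(\<lambda>v. cmod (indicator (level E r n) v)) ` level E r m = {if m = n then 1 else 0}"
    using assms by (auto simp: level_def indicator_def)
  then show ?thesis
    by (simp add: hardy_mean_def)
qed

lemma hardy_norm_indicator_level:
  assumes "\<And>n. level E r n \<noteq> {}"
  shows "hardy_norm E r \<infinity> (indicator (level E r n)) = 1"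
  unfolding hardy_norm_def hardy_mean_indicator_level[OF assms]
  by (intro antisym SUP_least SUP_upper2[of n]) auto

lemma indicator_level_hardy_space0:
  assumes "\<And>n. level E r n \<noteq> {}"
  shows "indicator (level E r n) \<in> hardy_space0 E r \<infinity>"
proof -
  have "(\<lambda>m. if m = n then 1 else 0 :: real) \<longlonglongrightarrow> 0"
    \<comment> \<open>The sequence vanishes from index \<open>Suc n\<close> on.\<close>
    by (rule tendsto_eventually) (auto simp: eventually_sequentially intro!: exI[of _ "Suc n"])
  moreover have "(1 :: ennreal) < \<infinity>"
    by simp
  ultimately show ?thesis
    by (simp add: hardy_space0_def hardy_space_def hardy_norm_indicator_level[OF assms]
        hardy_mean_indicator_level[OF assms] del: infinity_ennreal_def)
qed

text \<open>Letting \<open>X\<close> be any set between the small and the full space handles both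
  operators at once: the upper bound holds on the full space, and the test functions lie in the
  small one.\<close>

lemma op_norm_mult_op:
  assumes fin: "\<And>n. finite (level E r n)" and ne: "\<And>n. level E r n \<noteq> {}"
    and p: "0 < p" "p < \<infinity>"
    and X: "hardy_space0 E r \<infinity> \<subseteq> X" "X \<subseteq> hardy_space E r \<infinity>"
  shows "op_norm X (hardy_norm E r \<infinity>) (hardy_norm E r p) (mult_op \<psi>) = hardy_norm E r p \<psi>"
proof (rule antisym)
  show "op_norm X (hardy_norm E r \<infinity>) (hardy_norm E r p) (mult_op \<psi>) \<le> hardy_norm E r p \<psi>"
    unfolding op_norm_def
  proof (rule Sup_least, clarify)
    fix f assume "f \<in> X" "f \<noteq> (\<lambda>_. 0)"
    then have f: "0 < hardy_norm E r \<infinity> f" "hardy_norm E r \<infinity> f < \<infinity>"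
      using hardy_norm_infinity_pos[OF fin] X by (auto simp: hardy_space_def)
    have "hardy_norm E r p (mult_op \<psi> f) / hardy_norm E r \<infinity> f
        \<le> hardy_norm E r p \<psi> * hardy_norm E r \<infinity> f / hardy_norm E r \<infinity> f"
      by (intro divide_right_mono_ennreal hardy_norm_mult_le fin ne p)
    \<comment> \<open>Cancelling in \<open>ennreal\<close> is legitimate since the norm of
      \<open>f\<close> is neither 0 nor \<infinity>.\<close>
    also have "\<dots> = hardy_norm E r p \<psi>"
      using f by (simp add: ennreal_mult_divide_eq)
    finally show "hardy_norm E r p (mult_op \<psi> f) / hardy_norm E r \<infinity> f \<le> hardy_norm E r p \<psi>" .
  qed
  show "hardy_norm E r p \<psi> \<le> op_norm X (hardy_norm E r \<infinity>) (hardy_norm E r p) (mult_op \<psi>)"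
    unfolding hardy_norm_def[of E r p \<psi>]
  proof (rule SUP_least)
    fix n
    let ?f = "indicator (level E r n) :: 'a \<Rightarrow> complex"
    have "?f \<in> X" "?f \<noteq> (\<lambda>_. 0)"
      using indicator_level_hardy_space0[OF ne] X ne[of n] by (auto simp: fun_eq_iff indicator_def)
    \<comment> \<open>The indicator is 1 on level \<open>n\<close>, so \<open>\<psi>\<close> and its
      product with \<open>?f\<close> agree there.\<close>
    have "ennreal (hardy_mean E r p n \<psi>) = ennreal (hardy_mean E r p n (mult_op \<psi> ?f))"
      using p by (simp add: hardy_mean_def mult_op_def cong: sum.cong)
    also have "\<dots> \<le> hardy_norm E r p (mult_op \<psi> ?f) / hardy_norm E r \<infinity> ?f"
      unfolding hardy_norm_indicator_level[OF ne] using hardy_mean_le_norm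
      by (simp add: divide_ennreal_def)
    also have "\<dots> \<le> op_norm X (hardy_norm E r \<infinity>) (hardy_norm E r p) (mult_op \<psi>)"
      unfolding op_norm_def using \<open>?f \<in> X\<close> \<open>?f \<noteq> (\<lambda>_. 0)\<close> by (intro Sup_upper) blast
    finally show "ennreal (hardy_mean E r p n \<psi>) \<le> \<dots>" .
  qed
qed

theorem theorem2:
  fixes E :: "'a \<Rightarrow> 'a \<Rightarrow> bool" and r :: 'a and \<psi> :: "'a \<Rightarrow> complex" and p :: ennreal
  assumes tree: "is_tree E"
    and infinite_tree: "infinite (UNIV :: 'a set)"
    and finite_levels: "\<And>n. finite (level E r n)"
    and p_pos: "0 < p" and p_finite: "p < \<infinity>"
  shows "(bounded_op (hardy_space E r \<infinity>) (hardy_norm E r \<infinity>)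
                     (hardy_space E r p) (hardy_norm E r p) (mult_op \<psi>)
            \<longleftrightarrow> bounded_op (hardy_space0 E r \<infinity>) (hardy_norm E r \<infinity>)
                           (hardy_space0 E r p) (hardy_norm E r p) (mult_op \<psi>))
       \<and> (bounded_op (hardy_space0 E r \<infinity>) (hardy_norm E r \<infinity>)
                     (hardy_space0 E r p) (hardy_norm E r p) (mult_op \<psi>)
            \<longleftrightarrow> \<psi> \<in> hardy_space E r p)
       \<and> (\<psi> \<in> hardy_space E r p \<longrightarrow>
            op_norm (hardy_space E r \<infinity>) (hardy_norm E r \<infinity>) (hardy_norm E r p) (mult_op \<psi>)
              = hardy_norm E r p \<psi>
          \<and> op_norm (hardy_space0 E r \<infinity>) (hardy_norm E r \<infinity>) (hardy_norm E r p) (mult_op \<psi>)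
              = hardy_norm E r p \<psi>)"
proof -
  note ne = level_nonempty[OF tree infinite_tree finite_levels]
  note p = p_pos p_finite
  have sub: "hardy_space0 E r \<infinity> \<subseteq> hardy_space E r \<infinity>"
    by (auto simp: hardy_space0_def)
  note norm = op_norm_mult_op[OF finite_levels ne p sub order_refl]
  note norm0 = op_norm_mult_op[OF finite_levels ne p order_refl sub]
  note maps = mult_op_hardy_space[OF finite_levels ne p]
  note maps0 = mult_op_hardy_space0[OF finite_levels ne p]
  \<comment> \<open>By the norm formula, finiteness of the operator norm reads
    \<open>\<psi> \<in> hardy_space E r p\<close>, and this membership in turn yields the mapping
    property through \<open>maps\<close>.\<close>
  have "bounded_op (hardy_space E r \<infinity>) (hardy_norm E r \<infinity>)
      (hardy_space E r p) (hardy_norm E r p) (mult_op \<psi>) \<longleftrightarrow> \<psi> \<in> hardy_space E r p"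
    unfolding bounded_op_def norm using maps by (auto simp: hardy_space_def[of E r p])
  moreover have "bounded_op (hardy_space0 E r \<infinity>) (hardy_norm E r \<infinity>)
      (hardy_space0 E r p) (hardy_norm E r p) (mult_op \<psi>) \<longleftrightarrow> \<psi> \<in> hardy_space E r p"
    unfolding bounded_op_def norm0 using maps0 by (auto simp: hardy_space_def[of E r p])
  ultimately show ?thesis
    using norm norm0 by blast
qed

end
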